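(* Let $n$ and $k$ be positive integers. Then $$(n!!)^{k}-n^{k!!}=(k!!)^{n}-k^{n!!}$$ holds if and only if $k=n$ or $(k,n)\in\{(1,2),(2,1),(1,3),(3,1),(2,3),(3,2)\}$.
   Context: For a positive integer $m$, the double factorial $m!!$ is the product of all positive integers $\le m$ having the same parity as $m$, i.e. $m!!=m(m-2)(m-4)\cdots$, ending in $1$ if $m$ is odd and in $2$ if $m$ is even. *)

theory Defs
  imports Complex_Main
begin

definition double_fact :: "nat \<Rightarrow> nat" where
  "double_fact m = \<Prod>{i. 0 < i \<and> i \<le> m \<and> (even i \<longleftrightarrow> even m)}"

(* Agreement with the recursive form m!! = m (m - 2) (m - 4) ... *)

lemma double_fact_0: "double_fact 0 = 1"
proof -
  have "{i::nat. 0 < i \<and> i \<le> 0 \<and> (even i \<longleftrightarrow> even (0::nat))} = {}" by auto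
  then show ?thesis by (simp only: double_fact_def prod.empty)
qed

lemma double_fact_1: "double_fact (Suc 0) = 1"
proof -
  have "{i::nat. 0 < i \<and> i \<le> Suc 0 \<and> (even i \<longleftrightarrow> even (Suc 0))} = {Suc 0}"
    by (auto simp: le_Suc_eq)
  then show ?thesis by (simp add: double_fact_def)
qed

lemma double_fact_Suc_Suc:
  "double_fact (Suc (Suc m)) = Suc (Suc m) * double_fact m"
proof -
  let ?A = "{i. 0 < i \<and> i \<le> m \<and> (even i \<longleftrightarrow> even m)}"
  have "{i. 0 < i \<and> i \<le> Suc (Suc m) \<and> (even i \<longleftrightarrow> even (Suc (Suc m)))}
      = insert (Suc (Suc m)) ?A"
    by (auto simp: le_Suc_eq)
  moreover have "finite ?A" by simp
  ultimately show ?thesis by (simp add: double_fact_def)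
qed

end

theory Submission
  imports Defs
begin

text \<open>
  By symmetry let \<open>k < n\<close> and move all terms to the positive side. For \<open>k \<le> 3\<close> we have
  \<open>k!! = k\<close>, so \<open>n!! > n\<close> makes the left side too large unless \<open>n \<le> 3\<close>. For \<open>k \<ge> 4\<close> the
  single term \<open>k ^ n!!\<close> already dominates the right side, each of whose summands is at most half
  of it.
\<close>

lemmas double_fact_simps = double_fact_0 double_fact_1 double_fact_Suc_Suc

lemma double_fact_small [simp]:
  "double_fact 2 = 2" "double_fact 3 = 3" "double_fact 4 = 8" "double_fact 5 = 15"
  by (simp_all add: eval_nat_numeral double_fact_simps)

lemma double_fact_add_2: "double_fact (m + 2) = (m + 2) * double_fact m"
  by (simp add: double_fact_Suc_Suc)

lemma double_fact_rec:
  assumes "2 \<le> m"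
  shows "double_fact m = m * double_fact (m - 2)"
  using double_fact_add_2[of "m - 2"] unfolding le_add_diff_inverse2[OF assms] .

text \<open>Induction matched to the recursion of \<open>double_fact\<close>: two adjacent base
  cases cover both parity classes.\<close>

lemma induct_step_2 [consumes 1, case_names base1 base2 step]:
  fixes m :: nat
  assumes "m \<le> n" "P m" "P (Suc m)" "\<And>n. m \<le> n \<Longrightarrow> P n \<Longrightarrow> P (n + 2)"
  shows "P n"
  using assms(1)
proof (induction n rule: less_induct)
  case (less n)
  show ?case
  proof (cases "n = m \<or> n = Suc m")
    case False
    then have "m \<le> n - 2" "n - 2 < n" "n - 2 + 2 = n"
      using less.prems by auto
    then show ?thesis
      using less.IH[of "n - 2"] assms(4)[of "n - 2"] by simp
  qed (use assms in auto)
qed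

lemma double_fact_le_Suc: "double_fact m \<le> double_fact (Suc m)"
proof -
  have "0 \<le> m" by simp
  then show ?thesis
  proof (induction rule: induct_step_2)
    case (step m)
    then show ?case
      unfolding add_2_eq_Suc' double_fact_Suc_Suc by (intro mult_le_mono) simp_all
  qed (simp_all add: double_fact_simps)
qed

lemma mono_double_fact: "mono double_fact"
  by (simp add: mono_iff_le_Suc double_fact_le_Suc)

lemma double_fact_ge: "m \<le> double_fact m"
proof -
  have "0 \<le> m" by simp
  then show ?thesis
  proof (induction rule: induct_step_2)
    case (step m)
    have "1 \<le> double_fact m"
      using monoD[OF mono_double_fact, of 0 m] by (simp add: double_fact_0)
    then show ?case
      using mult_le_mono2[of 1 "double_fact m" "m + 2"] by (simp add: double_fact_Suc_Suc)
  qed (simp_all add: double_fact_simps)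
qed

lemma double_fact_gt:
  assumes "4 \<le> m"
  shows "m < double_fact m"
proof -
  have "double_fact m = m * double_fact (m - 2)"
    using assms by (intro double_fact_rec) simp
  moreover have "2 \<le> double_fact (m - 2)"
    using double_fact_ge[of "m - 2"] assms by linarith
  ultimately have "m * 2 \<le> double_fact m"
    by (simp only: mult_le_mono2)
  then show ?thesis
    using assms by linarith
qed

text \<open>Needed for adjacent arguments, which have opposite parity and so share no recursion. The
  constant 3/2 is attained at \<open>m = 2\<close>, and each step can only enlarge the ratio, since
  \<open>m + 2 \<le> m + 3\<close>.\<close>

lemma double_fact_ratio:
  assumes "2 \<le> m"
  shows "3 * double_fact m \<le> 2 * double_fact (Suc m)"
  using assms
proof (induction rule: induct_step_2)
  case (step m)
  have "3 * double_fact (m + 2) = (m + 2) * (3 * double_fact m)"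
    by (simp add: double_fact_Suc_Suc)
  also have "\<dots> \<le> (m + 3) * (2 * double_fact (Suc m))"
    by (intro mult_le_mono step) simp
  also have "\<dots> = 2 * double_fact (Suc (m + 2))"
    using double_fact_add_2[of "Suc m"] by (simp add: numeral_3_eq_3)
  finally show ?case .
qed simp_all

text \<open>The exponent \<open>m - 2\<close> is chosen so that \<open>(k - 2) * n\<close> later
  fits below \<open>n * double_fact (n - 2) = double_fact n\<close>. Equality holds at
  \<open>m = 4\<close>.\<close>

lemma double_fact_le_power:
  assumes "4 \<le> m"
  shows "2 * double_fact m \<le> m ^ (m - 2)"
  using assms
proof (induction rule: induct_step_2)
  case (step m)
  have "2 * double_fact (m + 2) = (m + 2) * (2 * double_fact m)"
    by (simp add: double_fact_Suc_Suc)
  also have "\<dots> \<le> (m + 2) * m ^ (m - 2)"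
    by (intro mult_le_mono2 step)
  also have "\<dots> \<le> (m + 2) * (m + 2) ^ (m - 2)"
    by (intro mult_le_mono2 power_mono) simp_all
  also have "\<dots> = (m + 2) ^ (m - 1)"
    using step(1) by (simp flip: power_Suc add: Suc_diff_le numeral_2_eq_2)
  also have "\<dots> \<le> (m + 2) ^ (m + 2 - 2)"
    by (intro power_increasing) simp_all
  finally show ?case .
qed simp_all

lemma two_mult_power_le:
  fixes b :: nat
  assumes "0 < e"
  shows "2 * b ^ e \<le> (2 * b) ^ e"
  using assms by (simp add: power_mult_distrib self_le_power)

lemma two_double_fact_power_le:
  assumes "4 \<le> k" "k < n"
  shows "2 * double_fact k ^ n \<le> k ^ double_fact n"
proof -
  have "2 * double_fact k ^ n \<le> (2 * double_fact k) ^ n"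
    using assms by (intro two_mult_power_le) simp
  also have "\<dots> \<le> (k ^ (k - 2)) ^ n"
    by (intro power_mono double_fact_le_power assms) simp
  also have "\<dots> = k ^ ((k - 2) * n)"
    by (simp add: power_mult)
  also have "\<dots> \<le> k ^ double_fact n"
  proof (rule power_increasing)
    have "k - 2 \<le> double_fact (n - 2)"
      using double_fact_ge[of "n - 2"] assms by linarith
    then have "(k - 2) * n \<le> n * double_fact (n - 2)"
      by (simp add: mult.commute)
    also have "\<dots> = double_fact n"
      using assms by (intro double_fact_rec[symmetric]) simp
    finally show "(k - 2) * n \<le> double_fact n" .
  qed (use assms in simp)
  finally show ?thesis .
qed

lemma two_power_double_fact_le:
  assumes "4 \<le> k" "k < n"
  shows "2 * n ^ double_fact k \<le> k ^ double_fact n"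
proof (cases "n = Suc k")
  case True
  let ?a = "double_fact k" and ?b = "double_fact n"
  have "4 \<le> ?a"
    using double_fact_ge[of k] assms by linarith
  have "2 * n\<^sup>2 \<le> k ^ 3"
  proof -
    \<comment> \<open>With this shift, \<open>k ^ 3 - 2 * (k + 1)\<^sup>2\<close> becomes a
      polynomial in \<open>j\<close> with positive coefficients.\<close>
    obtain j where "k = j + 4"
      using assms(1) by (metis add.commute le_Suc_ex)
    then show ?thesis
      using True by (simp add: power2_eq_square power3_eq_cube algebra_simps)
  qed
  \<comment> \<open>Squaring clears the denominator of the ratio 3/2: the exponents to compare
    become \<open>3 * ?a\<close> and \<open>2 * ?b\<close>.\<close>
  have "(2 * n ^ ?a)\<^sup>2 = 2\<^sup>2 * (n\<^sup>2) ^ ?a"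
    by (simp add: power_mult_distrib mult.commute flip: power_mult)
  also have "\<dots> \<le> 2 ^ ?a * (n\<^sup>2) ^ ?a"
    using \<open>4 \<le> ?a\<close> by (intro mult_le_mono1 power_increasing) simp_all
  also have "\<dots> = (2 * n\<^sup>2) ^ ?a"
    by (simp add: power_mult_distrib)
  also have "\<dots> \<le> (k ^ 3) ^ ?a"
    by (intro power_mono) (use \<open>2 * n\<^sup>2 \<le> k ^ 3\<close> in simp_all)
  also have "\<dots> = k ^ (3 * ?a)"
    by (simp add: power_mult)
  also have "\<dots> \<le> k ^ (2 * ?b)"
    using double_fact_ratio[of k] assms True by (intro power_increasing) simp_all
  also have "\<dots> = (k ^ ?b)\<^sup>2"
    by (simp add: mult.commute flip: power_mult)
  finally show ?thesis
    by (rule power2_le_imp_le) simp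
next
  case False
  let ?a = "double_fact k"
  have "2 * n ^ ?a \<le> (2 * n) ^ ?a"
    using double_fact_ge[of k] assms by (intro two_mult_power_le) linarith
  also have "\<dots> \<le> (k ^ n) ^ ?a"
  proof (rule power_mono)
    \<comment> \<open>Both factors are bounded separately, \<open>2 \<le> 2 ^ n\<close> and
      \<open>n < 2 ^ n\<close>, to reach the base 4, which is at most \<open>k\<close>.\<close>
    have "2 * n \<le> 2 ^ n * 2 ^ n"
      using assms by (intro mult_le_mono less_imp_le[OF less_exp] self_le_power) simp_all
    also have "\<dots> = 4 ^ n"
      by (simp flip: power_mult_distrib)
    also have "\<dots> \<le> k ^ n"
      using assms by (intro power_mono) simp_all
    finally show "2 * n \<le> k ^ n" .
  qed simp
  also have "\<dots> = k ^ (n * ?a)"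
    by (simp add: power_mult)
  also have "\<dots> \<le> k ^ double_fact n"
  proof (rule power_increasing)
    have "n * ?a \<le> n * double_fact (n - 2)"
      using False assms by (intro mult_le_mono2 monoD[OF mono_double_fact]) linarith
    also have "\<dots> = double_fact n"
      using assms by (intro double_fact_rec[symmetric]) simp
    finally show "n * ?a \<le> double_fact n" .
  qed (use assms in simp)
  finally show ?thesis .
qed

lemma double_fact_equation_less:
  assumes "0 < k" "k < n"
  shows "double_fact n ^ k + k ^ double_fact n = double_fact k ^ n + n ^ double_fact k
     \<longleftrightarrow> (k, n) \<in> {(1, 2), (1, 3), (2, 3)}"
proof (cases "4 \<le> n")
  case True
  have "n < double_fact n"
    using True by (rule double_fact_gt)
  have "double_fact k ^ n + n ^ double_fact k < double_fact n ^ k + k ^ double_fact n"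
  proof (cases "4 \<le> k")
    case True
    \<comment> \<open>The two halves add up only to a weak inequality; this summand makes it
      strict.\<close>
    have "0 < double_fact n ^ k"
      using \<open>n < double_fact n\<close> by simp
    then show ?thesis
      using two_double_fact_power_le[OF True assms(2)] two_power_double_fact_le[OF True assms(2)]
      by linarith
  next
    case False
    then have "k = 1 \<or> k = 2 \<or> k = 3"
      using assms by linarith
    then have "double_fact k = k"
      by (auto simp: double_fact_1)
    moreover have "n ^ k < double_fact n ^ k"
      using \<open>n < double_fact n\<close> assms by (intro power_strict_mono) simp_all
    moreover have "k ^ n \<le> k ^ double_fact n"
      using \<open>n < double_fact n\<close> assms by (intro power_increasing) simp_all
    ultimately show ?thesis by simp
  qed
  then show ?thesis
    using True by auto
next
  case False
  \<comment> \<open>Every pair with \<open>0 < k < n \<le> 3\<close> is a solution, so no further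
    case split is needed.\<close>
  then have "(k, n) \<in> {(1, 2), (1, 3), (2, 3)}"
    using assms by auto
  moreover from this have
    "double_fact n ^ k + k ^ double_fact n = double_fact k ^ n + n ^ double_fact k"
    by (auto simp: double_fact_1)
  ultimately show ?thesis by simp
qed

theorem theorem1p3:
  fixes n k :: nat
  assumes "0 < n" and "0 < k"
  shows "int (double_fact n) ^ k - int n ^ double_fact k
         = int (double_fact k) ^ n - int k ^ double_fact n
     \<longleftrightarrow> k = n \<or> (k, n) \<in> {(1, 2), (2, 1), (1, 3), (3, 1), (2, 3), (3, 2)}"
proof -
  have "int (double_fact n) ^ k - int n ^ double_fact k
         = int (double_fact k) ^ n - int k ^ double_fact n
     \<longleftrightarrow> int (double_fact n ^ k + k ^ double_fact n)
         = int (double_fact k ^ n + n ^ double_fact k)"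
    by (simp add: algebra_simps)
  also have "\<dots> \<longleftrightarrow> double_fact n ^ k + k ^ double_fact n
         = double_fact k ^ n + n ^ double_fact k"
    by (rule of_nat_eq_iff)
  also have "\<dots> \<longleftrightarrow> k = n \<or> (k, n) \<in> {(1, 2), (2, 1), (1, 3), (3, 1), (2, 3), (3, 2)}"
  proof (cases k n rule: linorder_cases)
    case less
    then show ?thesis
      using double_fact_equation_less[OF assms(2) less] by auto
  next
    \<comment> \<open>Exchanging \<open>k\<close> and \<open>n\<close> also exchanges the two sides
      of the equation, hence the \<open>eq_commute\<close>.\<close>
    case greater
    then show ?thesis
      using double_fact_equation_less[OF assms(1) greater]
      by (subst eq_commute) (auto simp del: of_nat_add)
  qed simp
  finally show ?thesis .
qed

end
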